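(* Let $A_1, A_2, \ldots, A_n \in \mathbb{S}^{d-1}(O,1)$, with $n > 2$, $d > 1$, and let $\lambda \in \mathbb{R}$. For each $i \in \{1,2,\ldots,n\}$, let $P_{\lambda,i}^{n-1}$ denote the $P_\lambda$ point of the sub-polygon $A_1A_2\ldots A_n \setminus A_i$ (obtained by deleting the $i$-th vertex), i.e. the point with position vector $\lambda\sum_{j\neq i} a_j$, and let $P_\lambda^n$ be the $P_\lambda$ point of $A_1A_2\ldots A_n$, i.e. the point with position vector $\lambda\sum_{j=1}^n a_j$. Then the following holds: 1. the multidimensional polygon $P_{\lambda,1}^{n-1}P_{\lambda,2}^{n-1}\ldots P_{\lambda,n}^{n-1}$ is inscribed in the hypersphere $\mathbb{S}^{d-1}(P_\lambda^n, |\lambda|)$; 2. each hypersphere $\mathbb{S}^{d-1}(P_{\lambda,i}^{n-1}, |\lambda|)$ passes through $P_\lambda^n$; 3. there exists a homothety $\Phi_T^{-\lambda}$ (with some center $T$ and ratio $-\lambda$) that maps the multidimensional polygon $A_1A_2\ldots A_n$ to the multidimensional polygon $P_{\lambda,1}^{n-1}P_{\lambda,2}^{n-1}\ldots P_{\lambda,n}^{n-1}$; 4. the lines $A_iP_{\lambda,i}^{n-1}$ concur at a point on the Euler line of $A_1A_2\ldots A_n$.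
   Context: $O$ is the origin of $\mathbb{R}^d$, and the position vector of a point is denoted by the corresponding lowercase letter (so $a_j$ is the position vector of $A_j$). For a point $Q\in\mathbb{R}^d$ and a real $r\ge 0$, $\mathbb{S}^{d-1}(Q,r)\subset\mathbb{R}^d$ is the $(d-1)$-dimensional hypersphere with center $Q$ and radius $r$. A multidimensional polygon is a set of points in $\mathbb{R}^d$ taken in cyclic order, with no further structure considered; the points $A_1,\ldots,A_n$ are not required to be distinct or to form a non-degenerate structure. For points $A_1,\dots,A_m \in \mathbb{S}^{d-1}(O,1)$ (with $m$ a positive integer, $d>1$) and $\lambda\in\mathbb{R}$, the $P_\lambda$ point of $A_1A_2\ldots A_m$ is the point with position vector $p_\lambda = \lambda\sum_{j=1}^m a_j$. The Euler line of $A_1A_2\ldots A_m$ is the set $\{P_\mu : \mu\in\mathbb{R}\}$ of all its $P_\mu$ points. For a point $X\in\mathbb{R}^d$ with position vector $x_0$ and $\mu\in\mathbb{R}$, $\Phi_X^\mu$ denotes the homothety centered at $X$ with ratio $\mu$, i.e. the map $x\mapsto \mu(x-x_0)+x_0$.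
   Formalization: Parts 3 and 4 are stated only for λ ≠ −1; for λ = −1 they fail, e.g. for A = (1,0),(1,0),(0,1) in the plane, where the ratio-1 homothety is the identity but A_i ↦ P_{λ,i} is a nonzero translation and the lines are parallel. *)

theory Defs
  imports "HOL-Analysis.Analysis"
begin

text \<open>
  A multidimensional polygon is a family \<open>A\<close> of points together with the finite set \<open>J\<close> of
  natural numbers indexing its vertices, listed in increasing (cyclic) order. Vertices need not be
  distinct. Deleting the vertex \<open>A i\<close> means passing from \<open>J\<close> to \<open>J - {i}\<close>.
\<close>

definition P_point :: "real \<Rightarrow> nat set \<Rightarrow> (nat \<Rightarrow> 'a::real_vector) \<Rightarrow> 'a" where
  "P_point lam J A = lam *\<^sub>R (\<Sum>j\<in>J. A j)"

text \<open>The Euler line degenerates to the origin when the vertices sum to zero.\<close>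

definition Euler_line :: "nat set \<Rightarrow> (nat \<Rightarrow> 'a::real_vector) \<Rightarrow> 'a set" where
  "Euler_line J A = {P_point \<mu> J A |\<mu>. True}"

text \<open>
  Every real ratio is allowed: ratio \<open>0\<close> is constant, and ratio \<open>1\<close> is the identity
  (never a proper translation).
\<close>

definition homothety :: "'a::real_vector \<Rightarrow> real \<Rightarrow> 'a \<Rightarrow> 'a" where
  "homothety X \<mu> x = \<mu> *\<^sub>R (x - X) + X"

text \<open>For coinciding points this is the singleton consisting of the common point.\<close>

definition line_through :: "'a::real_vector \<Rightarrow> 'a \<Rightarrow> 'a set" where
  "line_through X Y = affine hull {X, Y}"

end

(* All claims follow from P_{lam,i} = P_lam - lam a_i. The centre of the homothety of ratio -lam is
   forced to be P_mu with mu = lam / (1 + lam), which lies on the Euler line; for lam \<noteq> -1 the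
   centre lies on every line joining a point to its image, so the lines in part 4 concur there. *)
theory Submission imports Defs begin

lemma P_point_remove:
  assumes "finite J" "i \<in> J"
  shows "P_point lam (J - {i}) A = P_point lam J A - lam *\<^sub>R A i"
  using assms by (simp add: P_point_def sum_diff1 scaleR_diff_right)

text \<open>Every \<open>A i\<close> is sent to its \<open>P_point\<close> by the one map x -> p -
  lam x, where p = \<open>P_point lam J A\<close>. The centre is the fixed point c of this map: (1 +
  lam) c = p.\<close>

lemma homothety_P_point:
  assumes "lam \<noteq> -1" "finite J" "i \<in> J"
  shows "homothety (P_point (lam / (1 + lam)) J A) (- lam) (A i) = P_point lam (J - {i}) A"
proof -
  define S where "S = (\<Sum>j\<in>J. A j)"
  have "homothety (P_point (lam / (1 + lam)) J A) (- lam) (A i)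
      = (lam * (lam / (1 + lam)) + lam / (1 + lam)) *\<^sub>R S - lam *\<^sub>R A i"
    by (simp add: homothety_def P_point_def S_def algebra_simps)
  also have "lam * (lam / (1 + lam)) + lam / (1 + lam) = lam"
  proof -
    have "1 + lam \<noteq> 0"
      using assms(1) by linarith
    then show ?thesis
      by (simp add: divide_simps) (simp add: algebra_simps)
  qed
  finally show ?thesis
    using assms(2,3) by (simp add: P_point_remove) (simp add: P_point_def S_def)
qed

text \<open>Solving the homothety equation for \<open>X\<close> gives an affine combination of
  \<open>x\<close> and its image. This also covers \<open>x = X\<close>, where the line is a single
  point.\<close>

lemma center_in_line_through_homothety:
  assumes "\<mu> \<noteq> 1"
  shows "X \<in> line_through x (homothety X \<mu> x)"
proof -
  have "(- \<mu> / (1 - \<mu>)) *\<^sub>R x + (1 / (1 - \<mu>)) *\<^sub>R homothety X \<mu> x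
      = (1 / (1 - \<mu>)) *\<^sub>R (homothety X \<mu> x - \<mu> *\<^sub>R x)"
    by (simp add: scaleR_diff_right)
  also have "homothety X \<mu> x - \<mu> *\<^sub>R x = (1 - \<mu>) *\<^sub>R X"
    by (simp add: homothety_def algebra_simps)
  finally have "X = (- \<mu> / (1 - \<mu>)) *\<^sub>R x + (1 / (1 - \<mu>)) *\<^sub>R homothety X \<mu> x"
    using assms by simp
  moreover have "- \<mu> / (1 - \<mu>) + 1 / (1 - \<mu>) = 1"
    using assms by (simp add: field_simps)
  ultimately show ?thesis
    unfolding line_through_def affine_hull_2 by blast
qed

text \<open>At \<open>lam = -1\<close> the ratio is 1, so the homothety is the identity, whereas
  \<open>A i\<close> should move by minus the vertex sum. If that sum is nonzero, no centre exists
  and the lines are parallel or equal. Hence the guard on the last two claims.\<close>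

theorem theorem2p2:
  fixes A :: "nat \<Rightarrow> real ^ 'd" and n :: nat and lam :: real
  assumes "CARD('d) > 1" and "n > 2"
    and "\<forall>i\<in>{1..n}. A i \<in> sphere 0 1"
  shows "(\<forall>i\<in>{1..n}. P_point lam ({1..n} - {i}) A \<in> sphere (P_point lam {1..n} A) \<bar>lam\<bar>)
    \<and> (\<forall>i\<in>{1..n}. P_point lam {1..n} A \<in> sphere (P_point lam ({1..n} - {i}) A) \<bar>lam\<bar>)
    \<and> (lam \<noteq> -1 \<longrightarrow>
        (\<exists>T. \<forall>i\<in>{1..n}. homothety T (- lam) (A i) = P_point lam ({1..n} - {i}) A))
    \<and> (lam \<noteq> -1 \<longrightarrow>
        (\<exists>X\<in>Euler_line {1..n} A. \<forall>i\<in>{1..n}. X \<in> line_through (A i) (P_point lam ({1..n} - {i}) A)))"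
proof -
  let ?J = "{1..n}"
  let ?T = "P_point (lam / (1 + lam)) ?J A"
  \<comment> \<open>The two points differ by \<open>lam *\<^sub>R A i\<close> with
    \<open>A i\<close> a unit vector; by symmetry of distance this yields both sphere
    claims.\<close>
  have dist: "dist (P_point lam ?J A) (P_point lam (?J - {i}) A) = \<bar>lam\<bar>" if "i \<in> ?J" for i
    using that assms(3) by (simp add: P_point_remove dist_norm)
  have hom: "\<forall>i\<in>?J. homothety ?T (- lam) (A i) = P_point lam (?J - {i}) A" if "lam \<noteq> -1"
    using that by (intro ballI homothety_P_point) auto
  have line: "\<forall>i\<in>?J. ?T \<in> line_through (A i) (P_point lam (?J - {i}) A)" if "lam \<noteq> -1"
  proof
    fix i assume "i \<in> ?J"
    have "- lam \<noteq> 1"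
      using that by linarith
    then have "?T \<in> line_through (A i) (homothety ?T (- lam) (A i))"
      by (rule center_in_line_through_homothety)
    with hom[OF that] \<open>i \<in> ?J\<close> show "?T \<in> line_through (A i) (P_point lam (?J - {i}) A)"
      by metis
  qed
  have "?T \<in> Euler_line ?J A"
    by (auto simp: Euler_line_def)
  with hom line have
    "lam \<noteq> -1 \<longrightarrow> (\<exists>T. \<forall>i\<in>?J. homothety T (- lam) (A i) = P_point lam (?J - {i}) A)"
    "lam \<noteq> -1 \<longrightarrow> (\<exists>X\<in>Euler_line ?J A. \<forall>i\<in>?J. X \<in> line_through (A i) (P_point lam (?J - {i}) A))"
    by blast+
  with dist show ?thesis
    by (simp add: dist_commute)
qed

end
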